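(* Let $n\geq 2$ be an integer. Then for every integer $k > (n-1)^2$, $$a^a_n(k) = 2a^a_n(k-1)-a^a_n(k-2)+\left\lfloor \frac{(n-1)^2}{2}\right\rfloor .$$
   Context: For integers $n\geq 1$ and $k\geq 0$, the $n$ by $k$ grid is the set of points $\{1,\dots,n\}\times\{1,\dots,k\}\subset\mathbb{R}^2$ (empty if $k=0$, so that $a^a_n(0)=0$). $a^a_n(k)$ denotes the number of acute isosceles triangles of nonzero area formed by 3 distinct points of the $n$ by $k$ grid, i.e. the number of 3-element non-collinear subsets of the grid that are the vertices of a triangle with at least two sides of equal Euclidean length and with all angles strictly less than $90^\circ$. *)

theory Defs
  imports "HOL-Analysis.Analysis"
begin

(* The interior angle at A in radians; only meaningful if B and C differ from A. *)
definition vertex_angle :: "'a::real_inner \<Rightarrow> 'a \<Rightarrow> 'a \<Rightarrow> real" where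
  "vertex_angle B A C = arccos (((B - A) \<bullet> (C - A)) / (norm (B - A) * norm (C - A)))"

definition isosceles :: "'a::real_inner \<Rightarrow> 'a \<Rightarrow> 'a \<Rightarrow> bool" where
  "isosceles A B C \<longleftrightarrow> dist A B = dist A C \<or> dist B A = dist B C \<or> dist C A = dist C B"

definition acute :: "'a::real_inner \<Rightarrow> 'a \<Rightarrow> 'a \<Rightarrow> bool" where
  "acute A B C \<longleftrightarrow>
     vertex_angle B A C < pi / 2 \<and> vertex_angle A B C < pi / 2 \<and> vertex_angle A C B < pi / 2"

(* The type real * real carries the Euclidean metric and inner product. *)
definition grid :: "nat \<Rightarrow> nat \<Rightarrow> (real \<times> real) set" where
  "grid n k = (real ` {1..n}) \<times> (real ` {1..k})"

definition acute_isosceles_triangles :: "nat \<Rightarrow> nat \<Rightarrow> (real \<times> real) set set" where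
  "acute_isosceles_triangles n k =
     {T. T \<subseteq> grid n k \<and> card T = 3 \<and> \<not> collinear T \<and>
         (\<exists>A B C. T = {A, B, C} \<and> isosceles A B C \<and> acute A B C)}"

definition num_acute_isosceles :: "nat \<Rightarrow> nat \<Rightarrow> nat" where
  "num_acute_isosceles n k = card (acute_isosceles_triangles n k)"

end

theory Submission
  imports Defs
begin

text \<open>
  Deleting the top row of the grid, or the bottom row, leaves a copy of the grid of height
  \<open>k - 1\<close>, and deleting both leaves one of height \<open>k - 2\<close>. By inclusion-exclusion the second
  difference of the count is therefore the number of triangles that touch both the bottom and
  the top row (\<open>second_difference\<close>).

  Put \<open>m = n - 1\<close> for the width of the grid and \<open>h = k - 1 \<ge> m\<^sup>2\<close> for its height. If the third
  vertex of such a spanning triangle lay at height \<open>r\<close> strictly between the two rows, an acute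
  angle there would force a product of two horizontal differences, at most \<open>m\<^sup>2\<close>, to exceed
  \<open>r * (h - r) \<ge> h - 1\<close>. This leaves only \<open>h = m\<^sup>2\<close> with the vertex one unit away from a row
  and the other two vertices in one column, and such a triangle is not isosceles
  (\<open>no_vertex_strictly_between\<close>). So two vertices share a row. The two other sides are then too
  steep to be as short as that base without a right or obtuse angle at the base, so the apex lies
  over the midpoint of the base (\<open>acute_isosceles_horizontal_base_iff\<close>).

  Hence spanning triangles correspond to a choice of the row of the base, and two columns
  \<open>a < c\<close> of equal parity. There are \<open>\<lfloor>m\<^sup>2 / 4\<rfloor>\<close> such pairs of columns, and twice this number is
  \<open>\<lfloor>m\<^sup>2 / 2\<rfloor>\<close>, since \<open>m\<^sup>2\<close> is \<open>0\<close> or \<open>1\<close> modulo \<open>4\<close>.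
\<close>

section \<open>Acute isosceles triangles in coordinates\<close>

text \<open>
  The degenerate cases agree as well: if \<open>A\<close> equals \<open>B\<close> or \<open>C\<close>, the quotient inside the arccosine
  is \<open>0 / 0 = 0\<close> and the angle is \<open>pi / 2\<close>. So an acute triple is automatically
  distinct.
\<close>
lemma vertex_angle_less_pi_half_iff:
  "vertex_angle B A C < pi / 2 \<longleftrightarrow> (B - A) \<bullet> (C - A) > 0"
proof -
  define t where "t = ((B - A) \<bullet> (C - A)) / (norm (B - A) * norm (C - A))"
  have t: "\<bar>t\<bar> \<le> 1"
    unfolding t_def abs_divide using Cauchy_Schwarz_ineq2[of "B - A" "C - A"]
    by (auto simp: divide_le_eq_1)
  have "arccos t < pi / 2 \<longleftrightarrow> 0 < t"
    using arccos_less_arccos[of 0 t] arccos_le_arccos[of t 0] t by force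
  also have "0 < t \<longleftrightarrow> (B - A) \<bullet> (C - A) > 0"
    by (cases "B = A \<or> C = A") (auto simp: t_def zero_less_divide_iff zero_less_mult_iff mult_less_0_iff)
  finally show ?thesis
    by (simp add: vertex_angle_def t_def)
qed

lemma acute_iff_inner:
  "acute A B C \<longleftrightarrow>
     (B - A) \<bullet> (C - A) > 0 \<and> (A - B) \<bullet> (C - B) > 0 \<and> (A - C) \<bullet> (B - C) > 0"
  unfolding acute_def vertex_angle_less_pi_half_iff ..

lemma between_imp_inner_nonpos:
  assumes "between (B, C) A"
  shows "(B - A) \<bullet> (C - A) \<le> 0"
proof -
  obtain u where u: "0 \<le> u" "u \<le> 1" "A = (1 - u) *\<^sub>R B + u *\<^sub>R C"
    using assms by (auto simp: between_def closed_segment_def)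
  have "B - A = (- u) *\<^sub>R (C - B)" "C - A = (1 - u) *\<^sub>R (C - B)"
    by (simp_all add: u(3) algebra_simps)
  then have "(B - A) \<bullet> (C - A) = - (u * (1 - u) * ((C - B) \<bullet> (C - B)))"
    by (metis (no_types, opaque_lifting) inner_scaleR_left inner_scaleR_right mult.assoc mult_minus_left)
  also have "\<dots> \<le> 0"
    using u by simp
  finally show ?thesis .
qed

text \<open>
  Of three collinear points one lies between the other two, and sees them at an angle that is
  not acute.
\<close>
lemma acute_imp_not_collinear:
  fixes A B C :: "'a::euclidean_space"
  assumes "acute A B C"
  shows "\<not> collinear {A, B, C}"
  using assms between_imp_inner_nonpos[of B C A] between_imp_inner_nonpos[of C A B]
    between_imp_inner_nonpos[of A B C]
  by (auto simp: acute_iff_inner collinear_between_cases inner_commute)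

lemma acute_imp_card:
  assumes "acute A B C"
  shows "card {A, B, C} = 3"
proof -
  have "A \<noteq> B" "A \<noteq> C" "B \<noteq> C"
    using assms by (auto simp: acute_iff_inner)
  then show ?thesis by simp
qed

definition acute_isosceles :: "'a::real_inner \<Rightarrow> 'a \<Rightarrow> 'a \<Rightarrow> bool" where
  "acute_isosceles A B C \<longleftrightarrow> isosceles A B C \<and> acute A B C"

lemma acute_isosceles_perm:
  "acute_isosceles A B C \<longleftrightarrow> acute_isosceles B A C"
  "acute_isosceles A B C \<longleftrightarrow> acute_isosceles A C B"
  by (auto simp: acute_isosceles_def isosceles_def acute_iff_inner inner_commute)

text \<open>
  Any two vertices of a triangle may be listed first; this picks the vertices on the two border
  rows without loss of generality.
\<close>
lemma acute_isosceles_third_vertex: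
  assumes "acute_isosceles A B C" and "P \<in> {A, B, C}" "Q \<in> {A, B, C}" "P \<noteq> Q"
  shows "\<exists>W. {A, B, C} = {P, Q, W} \<and> acute_isosceles P Q W"
proof -
  have perms: "acute_isosceles A C B" "acute_isosceles B A C" "acute_isosceles B C A"
    "acute_isosceles C A B" "acute_isosceles C B A"
    using assms(1) by (auto simp: acute_isosceles_def isosceles_def acute_iff_inner inner_commute)
  consider "P = A" "Q = B" | "P = A" "Q = C" | "P = B" "Q = A" | "P = B" "Q = C"
    | "P = C" "Q = A" | "P = C" "Q = B"
    using assms(2-4) by blast
  then show ?thesis
  proof cases
    case 1 then show ?thesis using assms(1) by (intro exI[of _ C]) auto
  next
    case 2 then show ?thesis using perms by (intro exI[of _ B]) auto
  next
    case 3 then show ?thesis using perms by (intro exI[of _ C]) auto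
  next
    case 4 then show ?thesis using perms by (intro exI[of _ A]) auto
  next
    case 5 then show ?thesis using perms by (intro exI[of _ B]) auto
  next
    case 6 then show ?thesis using perms by (intro exI[of _ A]) auto
  qed
qed

lemma acute_isosceles_translation:
  "acute_isosceles (v + A) (v + B) (v + C) \<longleftrightarrow> acute_isosceles A B C"
  by (simp add: acute_isosceles_def isosceles_def acute_iff_inner)

text \<open>
  Acuteness implies that the vertices are distinct and not collinear, so these two requirements
  on \<open>T\<close> can be left out.
\<close>
lemma acute_isosceles_triangles_iff:
  "T \<in> acute_isosceles_triangles n k \<longleftrightarrow>
     T \<subseteq> grid n k \<and> (\<exists>A B C. T = {A, B, C} \<and> acute_isosceles A B C)"
  using acute_imp_not_collinear acute_imp_card
  unfolding acute_isosceles_triangles_def acute_isosceles_def by blast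

lemma acute_isosceles_coords:
  fixes a b c d e f :: real
  shows "acute_isosceles (a, b) (c, d) (e, f) \<longleftrightarrow>
    ((a - c)\<^sup>2 + (b - d)\<^sup>2 = (a - e)\<^sup>2 + (b - f)\<^sup>2 \<or>
     (a - c)\<^sup>2 + (b - d)\<^sup>2 = (c - e)\<^sup>2 + (d - f)\<^sup>2 \<or>
     (a - e)\<^sup>2 + (b - f)\<^sup>2 = (c - e)\<^sup>2 + (d - f)\<^sup>2) \<and>
    (c - a) * (e - a) + (d - b) * (f - b) > 0 \<and>
    (a - c) * (e - c) + (b - d) * (f - d) > 0 \<and>
    (a - e) * (c - e) + (b - f) * (d - f) > 0"
  by (simp add: acute_isosceles_def isosceles_def acute_iff_inner dist_Pair_Pair dist_real_def
      power2_commute[of c a] power2_commute[of d b] power2_commute[of e a] power2_commute[of f b]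
      power2_commute[of e c] power2_commute[of f d])

section \<open>The second difference in the height of the grid\<close>

lemma mem_grid_iff:
  "P \<in> grid n k \<longleftrightarrow> (\<exists>i j. P = (real i, real j) \<and> 1 \<le> i \<and> i \<le> n \<and> 1 \<le> j \<and> j \<le> k)"
  by (auto simp: grid_def)

lemma finite_acute_isosceles_triangles: "finite (acute_isosceles_triangles n k)"
proof (rule finite_subset)
  show "acute_isosceles_triangles n k \<subseteq> Pow (grid n k)"
    by (auto simp: acute_isosceles_triangles_def)
qed (simp add: grid_def)

definition shift_up :: "(real \<times> real) set \<Rightarrow> (real \<times> real) set" where
  "shift_up T = (+) (0, 1) ` T"

lemma inj_shift_up: "inj shift_up"
  unfolding shift_up_def inj_def by (simp add: inj_image_eq_iff)

lemma mem_grid_shift: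
  assumes "k \<ge> 1"
  shows "(0, 1) + P \<in> grid n k \<and> snd ((0, 1) + P) \<noteq> 1 \<longleftrightarrow> P \<in> grid n (k - 1)"
proof
  assume L: "(0, 1) + P \<in> grid n k \<and> snd ((0, 1) + P) \<noteq> 1"
  then obtain i j where ij: "(0, 1) + P = (real i, real j)" "1 \<le> i" "i \<le> n" "1 \<le> j" "j \<le> k"
    by (auto simp: mem_grid_iff)
  with L have "j \<noteq> 1" by auto
  with ij have "P = (real i, real (j - 1)) \<and> 1 \<le> i \<and> i \<le> n \<and> 1 \<le> j - 1 \<and> j - 1 \<le> k - 1"
    by (cases P) auto
  then show "P \<in> grid n (k - 1)"
    unfolding mem_grid_iff by blast
next
  assume "P \<in> grid n (k - 1)"
  then obtain i j where ij: "P = (real i, real j)" "1 \<le> i" "i \<le> n" "1 \<le> j" "j \<le> k - 1"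
    by (auto simp: mem_grid_iff)
  then have "(0, 1) + P = (real i, real (j + 1)) \<and> 1 \<le> i \<and> i \<le> n \<and> 1 \<le> j + 1 \<and> j + 1 \<le> k"
    using assms by auto
  then show "(0, 1) + P \<in> grid n k \<and> snd ((0, 1) + P) \<noteq> 1"
    unfolding mem_grid_iff using ij by fastforce
qed

lemma shift_up_mem_iff:
  assumes "k \<ge> 1"
  shows "shift_up T \<in> acute_isosceles_triangles n k \<and> (\<forall>P\<in>shift_up T. snd P \<noteq> 1)
    \<longleftrightarrow> T \<in> acute_isosceles_triangles n (k - 1)"
proof -
  have in_grid: "shift_up T \<subseteq> grid n k \<and> (\<forall>P\<in>shift_up T. snd P \<noteq> 1) \<longleftrightarrow> T \<subseteq> grid n (k - 1)"
    using mem_grid_shift[OF assms] unfolding shift_up_def by blast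
  have shape: "(\<exists>A B C. shift_up T = {A, B, C} \<and> acute_isosceles A B C) \<longleftrightarrow>
      (\<exists>A B C. T = {A, B, C} \<and> acute_isosceles A B C)" (is "?L \<longleftrightarrow> ?R")
  proof
    assume ?L
    then obtain A B C where *: "shift_up T = {A, B, C}" "acute_isosceles A B C" by blast
    let ?v = "(0, 1) :: real \<times> real"
    have "shift_up T = shift_up {A - ?v, B - ?v, C - ?v}"
      using * by (simp add: shift_up_def)
    then have "T = {A - ?v, B - ?v, C - ?v}"
      using inj_shift_up by (simp add: inj_eq)
    moreover have "acute_isosceles (A - ?v) (B - ?v) (C - ?v)"
      using * acute_isosceles_translation[of ?v "A - ?v" "B - ?v" "C - ?v"] by simp
    ultimately show ?R by blast
  next
    assume ?R
    then obtain A B C where "T = {A, B, C}" "acute_isosceles A B C" by blast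
    then have "shift_up T = {(0, 1) + A, (0, 1) + B, (0, 1) + C}"
      "acute_isosceles ((0, 1) + A) ((0, 1) + B) ((0, 1) + C)"
      by (simp_all only: acute_isosceles_translation shift_up_def image_insert image_empty)
    then show ?L by blast
  qed
  show ?thesis
    unfolding acute_isosceles_triangles_iff in_grid[symmetric] shape[symmetric]
    by (simp only: conj_ac)
qed

lemma shift_up_image:
  assumes "k \<ge> 1"
  shows "shift_up ` acute_isosceles_triangles n (k - 1) =
    {T \<in> acute_isosceles_triangles n k. \<forall>P\<in>T. snd P \<noteq> 1}" (is "?L = ?R")
proof
  show "?L \<subseteq> ?R"
    using shift_up_mem_iff[OF assms] by blast
  show "?R \<subseteq> ?L"
  proof
    fix T assume T: "T \<in> ?R"
    have eq: "T = shift_up ((\<lambda>P. P - (0, 1)) ` T)"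
      by (simp add: shift_up_def image_image)
    with T have "(\<lambda>P. P - (0, 1)) ` T \<in> acute_isosceles_triangles n (k - 1)"
      using shift_up_mem_iff[OF assms] by force
    with eq show "T \<in> ?L" by blast
  qed
qed

lemma mem_acute_isosceles_triangles_pred_iff:
  assumes "k \<ge> 1"
  shows "T \<in> acute_isosceles_triangles n (k - 1) \<longleftrightarrow>
    T \<in> acute_isosceles_triangles n k \<and> (\<forall>P\<in>T. snd P \<noteq> real k)"
proof -
  have "P \<in> grid n (k - 1) \<longleftrightarrow> P \<in> grid n k \<and> snd P \<noteq> real k" for P
    using assms by (cases P) (auto simp: mem_grid_iff intro: le_neq_implies_less)
  then show ?thesis
    unfolding acute_isosceles_triangles_iff by blast
qed

definition spanning_triangles :: "nat \<Rightarrow> nat \<Rightarrow> (real \<times> real) set set" where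
  "spanning_triangles n k =
     {T \<in> acute_isosceles_triangles n k. (\<exists>P\<in>T. snd P = 1) \<and> (\<exists>Q\<in>T. snd Q = real k)}"

text \<open>
  The triangles missing the top row and the triangles missing the bottom row are each in bijection
  with those of height \<open>k - 1\<close>; their common members are shifted copies of those of height
  \<open>k - 2\<close>. What remains are the spanning triangles. The identity is kept additive because
  subtraction on natural numbers truncates.
\<close>
lemma second_difference:
  assumes "k \<ge> 2"
  shows "num_acute_isosceles n k + num_acute_isosceles n (k - 2) =
    2 * num_acute_isosceles n (k - 1) + card (spanning_triangles n k)"
proof -
  let ?S = "acute_isosceles_triangles n"
  define L where "L = ?S (k - 1)"
  define U where "U = shift_up ` ?S (k - 1)"
  \<comment> \<open>\<open>L\<close> consists of the triangles missing the top row, \<open>U\<close> of those missing the bottom row.\<close>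
  have cardU: "card U = card (?S (k - 1))"
    unfolding U_def by (rule card_image) (meson inj_on_subset inj_shift_up subset_UNIV)
  have fin: "finite L" "finite U" "finite (spanning_triangles n k)"
    using finite_acute_isosceles_triangles by (auto simp: L_def U_def spanning_triangles_def)
  have Leq: "L = {T \<in> ?S k. \<forall>P\<in>T. snd P \<noteq> real k}"
    using mem_acute_isosceles_triangles_pred_iff[of k _ n] assms unfolding L_def by auto
  have Ueq: "U = {T \<in> ?S k. \<forall>P\<in>T. snd P \<noteq> 1}"
    unfolding U_def using assms by (intro shift_up_image) simp
  have "L \<inter> U = {T \<in> ?S (k - 1). \<forall>P\<in>T. snd P \<noteq> 1}"
    unfolding Ueq L_def using mem_acute_isosceles_triangles_pred_iff[of k _ n] assms by auto
  also have "\<dots> = shift_up ` ?S (k - 2)"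
    using shift_up_image[of "k - 1" n] assms by (simp add: diff_diff_left numeral_2_eq_2)
  finally have cardLU: "card (L \<inter> U) = card (?S (k - 2))"
    by (metis card_image inj_on_subset inj_shift_up subset_UNIV)
  have "?S k = (L \<union> U) \<union> spanning_triangles n k"
    "(L \<union> U) \<inter> spanning_triangles n k = {}"
    unfolding Leq Ueq spanning_triangles_def by auto
  then have "card (?S k) = card (L \<union> U) + card (spanning_triangles n k)"
    using fin by (simp add: card_Un_disjoint)
  moreover have "card (L \<union> U) + card (L \<inter> U) = card L + card U"
    using fin card_Un_Int by metis
  ultimately show ?thesis
    using cardU cardLU by (simp add: num_acute_isosceles_def L_def)
qed

section \<open>Triangles spanning a tall grid\<close>

text \<open>
  Here \<open>(p, 0)\<close> and \<open>(q, h)\<close> are the vertices on the border rows and \<open>(w, r)\<close> is the third one;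
  \<open>angle\<close> says that the angle at \<open>(w, r)\<close> is acute, and the conclusion that no two sides are
  equal. Since \<open>r * (h - r) - (h - 1) = (r - 1) * (h - r - 1) \<ge> 0\<close>, integrality leaves no room
  between \<open>h - 1\<close> and the bound \<open>m\<^sup>2 \<le> h\<close>, and every estimate is an equality. Integrality is
  essential: over the reals a point close to a border row could be such a vertex.
\<close>
lemma no_vertex_strictly_between:
  fixes p q w r m h :: int
  assumes r: "0 < r" "r < h" and h: "m\<^sup>2 \<le> h"
    and bounds: "\<bar>p - w\<bar> \<le> m" "\<bar>q - w\<bar> \<le> m"
    and angle: "(p - w) * (q - w) > r * (h - r)"
  shows "\<not> ((p - q)\<^sup>2 + h\<^sup>2 = (p - w)\<^sup>2 + r\<^sup>2 \<or>
            (p - q)\<^sup>2 + h\<^sup>2 = (q - w)\<^sup>2 + (h - r)\<^sup>2 \<or>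
            (p - w)\<^sup>2 + r\<^sup>2 = (q - w)\<^sup>2 + (h - r)\<^sup>2)"
proof -
  define u v where "u = p - w" and "v = q - w"
  have pq: "p - q = u - v" by (simp add: u_def v_def)
  have sq: "u\<^sup>2 \<le> m\<^sup>2" "v\<^sup>2 \<le> m\<^sup>2"
    using bounds by (simp_all add: u_def v_def abs_le_square_iff[symmetric])
  have "(u - v)\<^sup>2 = u\<^sup>2 + v\<^sup>2 - 2 * (u * v)"
    by (simp add: power2_eq_square algebra_simps)
  moreover have "(r - 1) * (h - r - 1) \<ge> 0"
    using r by simp
  moreover have prod: "(r - 1) * (h - r - 1) = r * (h - r) - (h - 1)"
    by (simp add: algebra_simps)
  ultimately have uv: "(u - v)\<^sup>2 \<le> 0" "u * v = h" "r * (h - r) = h - 1" "m\<^sup>2 = h"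
    using angle h sq zero_le_power2[of "u - v"] unfolding u_def[symmetric] v_def[symmetric]
    by linarith+
  then have "u = v" by simp
  with uv have uh: "u\<^sup>2 = h" by (simp add: power2_eq_square)
  \<comment> \<open>A vertex halfway up, with equal sides to both border rows, would need \<open>h = 2\<close>, which is
    not a square.\<close>
  have "u\<^sup>2 \<noteq> 2"
  proof
    assume "u\<^sup>2 = 2"
    then have "\<bar>u\<bar> < 2" "\<bar>u\<bar> > 1"
      using abs_le_square_iff[of 2 u] abs_le_square_iff[of u 1] by simp_all
    then show False by simp
  qed
  then have "h \<noteq> 2" using uh by simp
  moreover have "h \<ge> 2" using r by simp
  ultimately have h3: "h \<ge> 3" by simp
  have "r = 1 \<or> h - r = 1"
    using prod uv by auto
  moreover have "h * h \<ge> 3 * h"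
    using h3 by simp
  then have "h * h > h + 1"
    using h3 by linarith
  ultimately show ?thesis
    using h3 unfolding pq u_def[symmetric] v_def[symmetric] \<open>u = v\<close>[symmetric] uh
    by (auto simp: power2_eq_square algebra_simps)
qed

text \<open>
  If a leg were as long as the base, the Pythagorean theorem and the height being at least the
  base would put the apex straight above a base vertex, giving a right angle there. Conversely, an
  apex over the midpoint at this height sees the base at an acute angle.
\<close>
lemma acute_isosceles_horizontal_base_iff:
  fixes a b c y z :: real
  assumes "a \<noteq> c" and "\<bar>a - c\<bar> \<le> \<bar>z - y\<bar>"
  shows "acute_isosceles (a, y) (c, y) (b, z) \<longleftrightarrow> 2 * b = a + c"
proof
  assume ai: "acute_isosceles (a, y) (c, y) (b, z)"
  have le: "(a - c)\<^sup>2 \<le> (y - z)\<^sup>2"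
    using assms(2) by (simp add: abs_le_square_iff[symmetric] abs_minus_commute)
  have pos: "(c - a) * (b - a) > 0" "(a - c) * (b - c) > 0"
    using ai by (auto simp: acute_isosceles_coords)
  then have "(a - b)\<^sup>2 > 0" "(c - b)\<^sup>2 > 0"
    by auto
  then have "(a - b)\<^sup>2 = (c - b)\<^sup>2"
    using ai le by (auto simp: acute_isosceles_coords)
  then show "2 * b = a + c"
    using assms(1) by (auto simp: power2_eq_iff)
next
  assume b: "2 * b = a + c"
  then have c: "c = 2 * b - a" by simp
  \<comment> \<open>With the half base \<open>d\<close>, the angle at the apex is acute because
    \<open>d\<^sup>2 < 4 * d\<^sup>2 \<le> (z - y)\<^sup>2\<close>.\<close>
  define d where "d = a - b"
  have "d\<^sup>2 > 0" using assms(1) c by (simp add: d_def)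
  have "(2 * d)\<^sup>2 \<le> (z - y)\<^sup>2"
    using assms(2) unfolding abs_le_square_iff[symmetric] by (simp add: c d_def)
  then have "d * d > 0" "4 * (d * d) \<le> (z - y) * (z - y)"
    using \<open>d\<^sup>2 > 0\<close> by (simp_all add: power2_eq_square)
  moreover have ac: "a = b + d" "c = b - d" using c by (simp_all add: d_def)
  ultimately show "acute_isosceles (a, y) (c, y) (b, z)"
    unfolding ac by (simp add: acute_isosceles_coords power2_eq_square algebra_simps)
qed

definition same_parity_pairs :: "nat \<Rightarrow> (nat \<times> nat) set" where
  "same_parity_pairs n = {(a, c). 1 \<le> a \<and> a < c \<and> c \<le> n \<and> even (a + c)}"

text \<open>
  The base lies in row \<open>y\<close> and the apex in row \<open>z\<close>. Integer division is exact on
  \<open>same_parity_pairs\<close>.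
\<close>
definition midpoint_triangle :: "nat \<Rightarrow> nat \<Rightarrow> nat \<times> nat \<Rightarrow> (real \<times> real) set" where
  "midpoint_triangle y z = (\<lambda>(a, c).
     {(real a, real y), (real c, real y), (real ((a + c) div 2), real z)})"

lemma spanning_third_vertex_on_border:
  assumes k: "k > (n - 1)\<^sup>2"
    and grid: "(real p, 1) \<in> grid n k" "(real q, real k) \<in> grid n k" "(real w, real s) \<in> grid n k"
    and ai: "acute_isosceles (real p, 1) (real q, real k) (real w, real s)"
  shows "s = 1 \<or> s = k"
proof (rule ccontr)
  assume not: "\<not> (s = 1 \<or> s = k)"
  have rng: "1 \<le> p" "p \<le> n" "1 \<le> q" "q \<le> n" "1 \<le> w" "w \<le> n" "1 < s" "s < k"
    using grid not by (auto simp: mem_grid_iff)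
  have "\<not> ((int p - int q)\<^sup>2 + (int k - 1)\<^sup>2 = (int p - int w)\<^sup>2 + (int s - 1)\<^sup>2 \<or>
        (int p - int q)\<^sup>2 + (int k - 1)\<^sup>2 = (int q - int w)\<^sup>2 + ((int k - 1) - (int s - 1))\<^sup>2 \<or>
        (int p - int w)\<^sup>2 + (int s - 1)\<^sup>2 = (int q - int w)\<^sup>2 + ((int k - 1) - (int s - 1))\<^sup>2)"
  proof (rule no_vertex_strictly_between[where m = "int n - 1"])
    have "int ((n - 1)\<^sup>2) < int k" using k by simp
    then show "(int n - 1)\<^sup>2 \<le> int k - 1"
      using rng by (simp add: of_nat_diff)
    have "(real p - real w) * (real q - real w) + (1 - real s) * (real k - real s) > 0"
      using ai by (simp add: acute_isosceles_coords)
    then have "real_of_int ((int p - int w) * (int q - int w) + (1 - int s) * (int k - int s)) > 0"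
      by simp
    then have "(int p - int w) * (int q - int w) + (1 - int s) * (int k - int s) > 0"
      by linarith
    then show "(int p - int w) * (int q - int w) > (int s - 1) * ((int k - 1) - (int s - 1))"
      by (simp add: algebra_simps)
  qed (use rng in auto)
  moreover have "real_of_int ((int p - int q)\<^sup>2 + (int k - 1)\<^sup>2) = real_of_int ((int p - int w)\<^sup>2 + (int s - 1)\<^sup>2) \<or>
      real_of_int ((int p - int q)\<^sup>2 + (int k - 1)\<^sup>2) = real_of_int ((int q - int w)\<^sup>2 + ((int k - 1) - (int s - 1))\<^sup>2) \<or>
      real_of_int ((int p - int w)\<^sup>2 + (int s - 1)\<^sup>2) = real_of_int ((int q - int w)\<^sup>2 + ((int k - 1) - (int s - 1))\<^sup>2)"
    using ai by (simp add: acute_isosceles_coords power2_commute)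
  ultimately show False
    unfolding of_int_eq_iff by blast
qed

lemma horizontal_base_triangle_in_image:
  assumes "y = 1 \<and> z = k \<or> y = k \<and> z = 1" and "n \<le> k"
    and grid: "(real a, real y) \<in> grid n k" "(real c, real y) \<in> grid n k"
    and ai: "acute_isosceles (real a, real y) (real c, real y) (real b, real z)"
  shows "{(real a, real y), (real c, real y), (real b, real z)}
    \<in> midpoint_triangle y z ` same_parity_pairs n"
proof -
  have rng: "1 \<le> a" "a \<le> n" "1 \<le> c" "c \<le> n"
    using grid by (auto simp: mem_grid_iff)
  have ne: "a \<noteq> c"
    using ai by (auto simp: acute_isosceles_coords)
  moreover have "\<bar>real a - real c\<bar> \<le> \<bar>real z - real y\<bar>"
    using assms(1,2) rng by auto
  ultimately have "2 * real b = real a + real c"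
    using ai acute_isosceles_horizontal_base_iff[of "real a" "real c" "real z" "real y" "real b"]
    by simp
  then have b: "2 * b = a + c" by linarith
  have "even (2 * b)" by simp
  then have par: "even (a + c)" "b = (a + c) div 2"
    unfolding b[symmetric] by simp_all
  show ?thesis
  proof (cases "a < c")
    case True
    then have "(a, c) \<in> same_parity_pairs n"
      using rng par by (simp add: same_parity_pairs_def)
    then show ?thesis
      by (rule rev_image_eqI) (simp add: midpoint_triangle_def par)
  next
    case False
    then have "(c, a) \<in> same_parity_pairs n"
      using rng par ne by (simp add: same_parity_pairs_def add.commute)
    then show ?thesis
      by (rule rev_image_eqI) (auto simp: midpoint_triangle_def par add.commute)
  qed
qed

lemma midpoint_triangle_spanning:
  assumes yz: "y = 1 \<and> z = k \<or> y = k \<and> z = 1" and k: "n \<le> k"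
    and ac: "(a, c) \<in> same_parity_pairs n"
  shows "midpoint_triangle y z (a, c) \<in> spanning_triangles n k"
proof -
  let ?b = "(a + c) div 2"
  have rng: "1 \<le> a" "a < c" "c \<le> n" "even (a + c)"
    using ac by (auto simp: same_parity_pairs_def)
  have "2 * ?b = a + c" using rng(4) by simp
  then have "2 * real ?b = real a + real c" by linarith
  moreover have "\<bar>real a - real c\<bar> \<le> \<bar>real z - real y\<bar>"
    using yz rng k by auto
  ultimately have "acute_isosceles (real a, real y) (real c, real y) (real ?b, real z)"
    using rng acute_isosceles_horizontal_base_iff[of "real a" "real c" "real z" "real y" "real ?b"]
    by simp
  moreover have "1 \<le> ?b" "?b \<le> n" "1 \<le> k" using rng k by auto
  moreover from this have "midpoint_triangle y z (a, c) \<subseteq> grid n k"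
    using rng yz by (auto simp: midpoint_triangle_def mem_grid_iff)
  moreover have "midpoint_triangle y z (a, c) =
      {(real a, real y), (real c, real y), (real ?b, real z)}"
    by (simp add: midpoint_triangle_def)
  ultimately have "midpoint_triangle y z (a, c) \<in> acute_isosceles_triangles n k"
    unfolding acute_isosceles_triangles_iff by blast
  then show ?thesis
    using yz by (auto simp: spanning_triangles_def midpoint_triangle_def)
qed

lemma spanning_triangles_eq:
  assumes k: "k > (n - 1)\<^sup>2" "k \<ge> 2" "n \<le> k"
  shows "spanning_triangles n k =
    midpoint_triangle 1 k ` same_parity_pairs n \<union> midpoint_triangle k 1 ` same_parity_pairs n"
    (is "_ = ?R")
proof
  show "?R \<subseteq> spanning_triangles n k"
    using midpoint_triangle_spanning[of 1 k k n] midpoint_triangle_spanning[of k 1 k n] k by auto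
  show "spanning_triangles n k \<subseteq> ?R"
  proof
    fix T assume "T \<in> spanning_triangles n k"
    then obtain A B C P Q where T: "T = {A, B, C}" "acute_isosceles A B C" "T \<subseteq> grid n k"
      and PQ: "P \<in> T" "snd P = 1" "Q \<in> T" "snd Q = real k"
      unfolding spanning_triangles_def acute_isosceles_triangles_iff by blast
    have "P \<noteq> Q" using PQ k by auto
    then have "\<exists>W. T = {P, Q, W} \<and> acute_isosceles P Q W"
      using T(1,2) PQ(1,3) acute_isosceles_third_vertex by blast
    then obtain W where W: "T = {P, Q, W}" "acute_isosceles P Q W" by blast
    obtain p where p: "P = (real p, 1)"
      using T(3) PQ unfolding mem_grid_iff by (metis mem_grid_iff snd_conv subsetD)
    obtain q where q: "Q = (real q, real k)"
      using T(3) PQ unfolding mem_grid_iff by (metis mem_grid_iff snd_conv subsetD)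
    obtain w s where w: "W = (real w, real s)"
      using T(3) W(1) by (metis insert_iff mem_grid_iff subsetD)
    have grid: "(real p, 1) \<in> grid n k" "(real q, real k) \<in> grid n k" "(real w, real s) \<in> grid n k"
      using T(3) W(1) p q w by auto
    consider "s = 1" | "s = k"
      using spanning_third_vertex_on_border[OF k(1) grid] W p q w by blast
    then show "T \<in> ?R"
    proof cases
      case 1
      then have "{(real p, real 1), (real w, real 1), (real q, real k)}
          \<in> midpoint_triangle 1 k ` same_parity_pairs n"
        using grid W p q w k acute_isosceles_perm(2)
        by (intro horizontal_base_triangle_in_image[where k = k]) auto
      moreover have "T = {(real p, real 1), (real w, real 1), (real q, real k)}"
        using W p q w 1 by auto
      ultimately show ?thesis by blast
    next
      case 2
      have "acute_isosceles Q W P"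
        using W(2) acute_isosceles_perm by metis
      then have "{(real q, real k), (real w, real k), (real p, real 1)}
          \<in> midpoint_triangle k 1 ` same_parity_pairs n"
        using grid p q w k 2
        by (intro horizontal_base_triangle_in_image[where k = k]) auto
      moreover have "T = {(real q, real k), (real w, real k), (real p, real 1)}"
        using W p q w 2 by auto
      ultimately show ?thesis by blast
    qed
  qed
qed

section \<open>Counting the spanning triangles\<close>

text \<open>
  The row with two vertices tells base from apex and recovers the pair of columns. This makes
  \<open>midpoint_triangle\<close> injective and keeps the two orientations apart.
\<close>
lemma midpoint_triangle_rows:
  assumes "y \<noteq> z"
  shows "{P \<in> midpoint_triangle y z (a, c). snd P = real y} = {(real a, real y), (real c, real y)}"
    and "{P \<in> midpoint_triangle y z (a, c). snd P = real z} = {(real ((a + c) div 2), real z)}"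
  using assms by (auto simp: midpoint_triangle_def)

lemma inj_on_midpoint_triangle:
  assumes "y \<noteq> z"
  shows "inj_on (midpoint_triangle y z) (same_parity_pairs n)"
proof (rule inj_onI, clarify)
  fix a c a' c'
  assume ac: "(a, c) \<in> same_parity_pairs n" "(a', c') \<in> same_parity_pairs n"
    and eq: "midpoint_triangle y z (a, c) = midpoint_triangle y z (a', c')"
  have "{(real a, real y), (real c, real y)} = {(real a', real y), (real c', real y)}"
    using arg_cong[OF eq, of "\<lambda>T. {P \<in> T. snd P = real y}"]
    by (simp only: midpoint_triangle_rows[OF assms])
  then have "a = a' \<and> c = c' \<or> a = c' \<and> c = a'"
    by (simp add: doubleton_eq_iff)
  then show "a = a' \<and> c = c'"
    using ac by (auto simp: same_parity_pairs_def)
qed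

lemma midpoint_triangle_images_disjoint:
  assumes "y \<noteq> z"
  shows "midpoint_triangle y z ` same_parity_pairs n \<inter> midpoint_triangle z y ` same_parity_pairs n = {}"
proof -
  have False
    if ac: "(a, c) \<in> same_parity_pairs n"
      and eq: "midpoint_triangle y z (a, c) = midpoint_triangle z y (a', c')" for a c a' c'
  proof -
    have "{(real a, real y), (real c, real y)} = {(real ((a' + c') div 2), real y)}"
      using arg_cong[OF eq, of "\<lambda>T. {P \<in> T. snd P = real y}"]
      by (simp only: midpoint_triangle_rows[OF assms]
          midpoint_triangle_rows[OF assms[symmetric]])
    then have "a = c"
      by (simp add: doubleton_eq_iff)
    then show False
      using ac by (simp add: same_parity_pairs_def)
  qed
  then show ?thesis
    unfolding disjoint_iff by (metis imageE surj_pair)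
qed

lemma finite_same_parity_pairs: "finite (same_parity_pairs n)"
  by (rule finite_subset[of _ "{..n} \<times> {..n}"]) (auto simp: same_parity_pairs_def)

lemma card_same_parity_below: "card {a. 1 \<le> a \<and> a \<le> n \<and> even (a + Suc n)} = n div 2"
proof -
  define p e where "p = n div 2" and "e = n mod 2"
  have n: "n = 2 * p + e" and e: "e = 0 \<or> e = 1"
    by (auto simp: p_def e_def)
  have "{a. 1 \<le> a \<and> a \<le> n \<and> even (a + Suc n)} = (\<lambda>i. 2 * i + 1 + e) ` {..<p}"
  proof (intro equalityI subsetI)
    fix a assume "a \<in> {a. 1 \<le> a \<and> a \<le> n \<and> even (a + Suc n)}"
    then have a: "1 \<le> a" "a \<le> n" "even (a + Suc n)"
      by blast+
    from a(3) obtain j where "a + Suc n = 2 * j"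
      by (rule evenE)
    with a have "a = 2 * (j - p - e - 1) + 1 + e" "j - p - e - 1 < p"
      using n e by auto
    then show "a \<in> (\<lambda>i. 2 * i + 1 + e) ` {..<p}" by blast
  qed (use e in \<open>auto simp: n\<close>)
  moreover have "inj_on (\<lambda>i. 2 * i + 1 + e) {..<p}"
    by (rule inj_onI) simp
  ultimately show ?thesis
    by (simp add: card_image p_def)
qed

text \<open>
  A new last column \<open>m + 2\<close> forms pairs with the \<open>(m + 1) div 2\<close> smaller columns of its parity.
\<close>
lemma card_same_parity_pairs: "2 * card (same_parity_pairs (Suc m)) = m\<^sup>2 div 2"
proof (induction m)
  case 0
  have "same_parity_pairs (Suc 0) = {}" by (auto simp: same_parity_pairs_def)
  then show ?case by simp
next
  case (Suc m)
  let ?N = "Suc (Suc m)"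
  let ?A = "{a. 1 \<le> a \<and> a \<le> Suc m \<and> even (a + ?N)}"
  have "same_parity_pairs ?N = same_parity_pairs (Suc m) \<union> ?A \<times> {?N}"
    by (auto simp: same_parity_pairs_def le_Suc_eq)
  moreover have "same_parity_pairs (Suc m) \<inter> ?A \<times> {?N} = {}"
    by (auto simp: same_parity_pairs_def)
  moreover have "finite ?A" by simp
  ultimately have "card (same_parity_pairs ?N) = card (same_parity_pairs (Suc m)) + Suc m div 2"
    using finite_same_parity_pairs card_same_parity_below[of "Suc m"]
    by (simp add: card_Un_disjoint card_cartesian_product)
  moreover have "(Suc m)\<^sup>2 div 2 = m\<^sup>2 div 2 + 2 * (Suc m div 2)"
  proof (cases "even m")
    case True
    then obtain p where "m = 2 * p" by blast
    then show ?thesis by (simp add: power2_eq_square)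
  next
    case False
    then obtain p where "m = 2 * p + 1" by (elim oddE)
    then show ?thesis by (simp add: power2_eq_square)
  qed
  ultimately show ?case using Suc.IH by simp
qed

theorem theorem10:
  fixes n k :: nat
  assumes "n \<ge> 2" and "k > (n - 1)\<^sup>2"
  shows "int (num_acute_isosceles n k) =
    2 * int (num_acute_isosceles n (k - 1)) - int (num_acute_isosceles n (k - 2))
      + \<lfloor>(real n - 1)\<^sup>2 / 2\<rfloor>"
proof -
  obtain m where m: "n = Suc m" "m \<ge> 1"
    using assms(1) by (cases n) auto
  have "m \<le> m\<^sup>2" using m by (simp add: power2_eq_square)
  then have k: "k \<ge> 2" "n \<le> k"
    using assms m by auto
  have "card (spanning_triangles n k) = 2 * card (same_parity_pairs n)"
    using spanning_triangles_eq[OF assms(2) k] k midpoint_triangle_images_disjoint[of 1 k n]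
      inj_on_midpoint_triangle[of 1 k n] inj_on_midpoint_triangle[of k 1 n]
    by (simp add: card_Un_disjoint card_image finite_same_parity_pairs)
  also have "\<dots> = m\<^sup>2 div 2"
    using card_same_parity_pairs m by simp
  finally have "int (card (spanning_triangles n k)) = int (m\<^sup>2 div 2)" by simp
  also have "\<dots> = \<lfloor>(real n - 1)\<^sup>2 / 2\<rfloor>"
    using floor_divide_of_nat_eq[of "m\<^sup>2" 2, where ?'a = real] m by simp
  finally show ?thesis
    using second_difference[OF k(1), of n] by linarith
qed

end
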